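(* Formulation (Dom) is valid for the Anchor-Robust Project Scheduling Problem, i.e. $$\mathrm{Proj}_h(\mathcal{P}_{Dom})\cap\{0,1\}^J=\mathcal{H},$$ where $\mathcal{H}$ is the set of incidence vectors of anchored sets, $\mathcal{P}_{Dom}$ is the set of pairs $(z,h)\in\mathbb{R}^{\bar J}\times[0,1]^J$ satisfying $$z_j-z_i\ge p_i\quad\forall (i,j)\in\mathcal{A},\qquad z_t\le M,\qquad z_j\ge 0\quad\forall j\in\bar J,$$ $$z_j-z_i\ge L_{ij}+(L^\Delta_{ij}-L_{ij})h_j\quad\forall i,j\in\bar J,\ i\prec j$$ (with the convention $h_t=0$), and $\mathrm{Proj}_h(\mathcal{P}_{Dom})=\{h:\ \exists z,\ (z,h)\in\mathcal{P}_{Dom}\}$.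
   Context: Let $J$ be a finite set of jobs and $\bar J=J\cup\{s,t\}$ with dummy jobs $s,t$ (start and end of the project). Let $G=(\bar J,\mathcal{A})$ be a directed acyclic graph with source $s$ and sink $t$; there is an arc $(s,i)$ (resp. $(i,t)$) for every $i\in J$ without predecessor (resp. successor) in $J$. For $q\in\mathbb{R}_+^J$ (with the convention $q_s=0$), $G(q)$ denotes $G$ with length $q_i$ on every arc $(i,j)\in\mathcal{A}$. A schedule of $G(q)$ is a vector $x\in\mathbb{R}_+^{\bar J}$ with $x_s=0$ and $x_j-x_i\ge q_i$ for every arc $(i,j)\in\mathcal{A}$; its makespan is $x_t$. Write $i\prec j$ if $i\ne j$ and there is a directed path from $i$ to $j$ in $G$, and for $i\prec j$ let $L_{G(q)}(i,j)$ be the length of a longest $i$–$j$ path in $G(q)$. Fix nominal processing times $p\in\mathbb{R}_+^J$, a deadline $M\ge 0$, and an uncertainty set $\Delta\subset\mathbb{R}_+^J$, nonempty and such that the following maxima exist. For $i\prec j$ let $L_{ij}=L_{G(p)}(i,j)$ and $L^\Delta_{ij}=\max_{\delta\in\Delta}L_{G(p+\delta)}(i,j)$. Given a schedule $x$ of $G(p)$, a subset $H\subseteq J$ is $x$-anchored if for every $\delta\in\Delta$ there exists a schedule $x^\delta$ of $G(p+\delta)$ such that $x^\delta_i=x_i$ for every $i\in H$. A subset $H\subseteq J$ is anchored if there exists a schedule $x$ of $G(p)$ with $x_t\le M$ such that $H$ is $x$-anchored. The Anchor-Robust Project Scheduling Problem is to find an anchored set (with a corresponding schedule) of maximum weight $\sum_{i\in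 H}w_i$ for given $w\in\mathbb{R}_+^J$. Formulation (Dom) is: maximize $\sum_{i\in J}w_ih_i$ over $(z,h)\in\mathcal{P}_{Dom}$ with $h\in\{0,1\}^J$. *)

theory Defs
  imports Complex_Main "HOL-Library.FuncSet" "HOL-Library.Indicator_Function"
    "Graph_Theory.Graph_Theory"
begin

text \<open>
  A vector indexed by a finite set \<open>I\<close> is an extensional function on \<open>I\<close>, so that
  \<open>I \<rightarrow>\<^sub>E {0..}\<close> is the nonnegative orthant of the space of real vectors indexed by \<open>I\<close>.
  The job set \<open>J\<close> may be empty; in that case no arc from \<open>s\<close> to \<open>t\<close> is required.
\<close>

locale project_network = pair_fin_digraph G
  for G :: "'v pair_pre_digraph" (structure) +
  fixes J :: "'v set" and s t :: 'v
  assumes verts_eq: "pverts G = J \<union> {s, t}"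
    and dummies: "s \<notin> J" "t \<notin> J" "s \<noteq> t"
    and acyclic: "\<nexists>c. cycle c"
    and source: "\<And>i. (i, s) \<notin> parcs G"
    and sink: "\<And>i. (t, i) \<notin> parcs G"
    and source_arcs: "\<And>i. i \<in> J \<Longrightarrow> \<forall>k\<in>J. (k, i) \<notin> parcs G \<Longrightarrow> (s, i) \<in> parcs G"
    and sink_arcs: "\<And>i. i \<in> J \<Longrightarrow> \<forall>k\<in>J. (i, k) \<notin> parcs G \<Longrightarrow> (i, t) \<in> parcs G"

text \<open>
  Zero extension of a vector indexed by \<open>J\<close>. It implements the conventions \<open>q\<^sub>s = 0\<close> and
  \<open>h\<^sub>t = 0\<close>; the remaining values \<open>q\<^sub>t\<close> and \<open>h\<^sub>s\<close> never occur in a constraint or in the length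
  of an arc, since no arc leaves \<open>t\<close> or enters \<open>s\<close>.
\<close>

definition zero_ext :: "'v set \<Rightarrow> ('v \<Rightarrow> real) \<Rightarrow> 'v \<Rightarrow> real" where
  "zero_ext J q i = (if i \<in> J then q i else 0)"

definition vec_plus :: "'v set \<Rightarrow> ('v \<Rightarrow> real) \<Rightarrow> ('v \<Rightarrow> real) \<Rightarrow> 'v \<Rightarrow> real" where
  "vec_plus J p \<delta> = (\<lambda>i\<in>J. p i + \<delta> i)"

definition precedes :: "'v pair_pre_digraph \<Rightarrow> 'v \<Rightarrow> 'v \<Rightarrow> bool" where
  "precedes G i j \<longleftrightarrow> i \<noteq> j \<and> i \<rightarrow>\<^sup>*\<^bsub>with_proj G\<^esub> j"

definition schedules ::
  "'v pair_pre_digraph \<Rightarrow> 'v set \<Rightarrow> 'v \<Rightarrow> ('v \<Rightarrow> real) \<Rightarrow> ('v \<Rightarrow> real) set" where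
  "schedules G J s q =
    {x \<in> pverts G \<rightarrow>\<^sub>E {0..}. x s = 0 \<and> (\<forall>(i, j)\<in>parcs G. x j - x i \<ge> zero_ext J q i)}"

definition longest_path ::
  "'v pair_pre_digraph \<Rightarrow> 'v set \<Rightarrow> ('v \<Rightarrow> real) \<Rightarrow> 'v \<Rightarrow> 'v \<Rightarrow> real" where
  "longest_path G J q i j =
    Max {wf_digraph.awalk_cost (\<lambda>(k, l). zero_ext J q k) P | P.
           pre_digraph.apath (with_proj G) i P j}"

text \<open>
  \<open>GREATEST\<close> is the maximum of a set only if that maximum exists, which
  \<open>robust_max_exists\<close> expresses.
\<close>

definition robust_longest_path ::
  "'v pair_pre_digraph \<Rightarrow> 'v set \<Rightarrow> ('v \<Rightarrow> real) \<Rightarrow> ('v \<Rightarrow> real) set \<Rightarrow> 'v \<Rightarrow> 'v \<Rightarrow> real" where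
  "robust_longest_path G J p \<Delta> i j =
    (GREATEST l. l \<in> (\<lambda>\<delta>. longest_path G J (vec_plus J p \<delta>) i j) ` \<Delta>)"

definition robust_max_exists ::
  "'v pair_pre_digraph \<Rightarrow> 'v set \<Rightarrow> ('v \<Rightarrow> real) \<Rightarrow> ('v \<Rightarrow> real) set \<Rightarrow> bool" where
  "robust_max_exists G J p \<Delta> \<longleftrightarrow>
    (\<forall>i j. precedes G i j \<longrightarrow>
      (\<exists>\<delta>\<in>\<Delta>. \<forall>\<delta>'\<in>\<Delta>.
        longest_path G J (vec_plus J p \<delta>') i j \<le> longest_path G J (vec_plus J p \<delta>) i j))"

definition schedule_anchored ::
  "'v pair_pre_digraph \<Rightarrow> 'v set \<Rightarrow> 'v \<Rightarrow> ('v \<Rightarrow> real) \<Rightarrow> ('v \<Rightarrow> real) set \<Rightarrow>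
    ('v \<Rightarrow> real) \<Rightarrow> 'v set \<Rightarrow> bool" where
  "schedule_anchored G J s p \<Delta> x H \<longleftrightarrow>
    H \<subseteq> J \<and> (\<forall>\<delta>\<in>\<Delta>. \<exists>y\<in>schedules G J s (vec_plus J p \<delta>). \<forall>i\<in>H. y i = x i)"

definition anchored ::
  "'v pair_pre_digraph \<Rightarrow> 'v set \<Rightarrow> 'v \<Rightarrow> 'v \<Rightarrow> ('v \<Rightarrow> real) \<Rightarrow> real \<Rightarrow> ('v \<Rightarrow> real) set \<Rightarrow>
    'v set \<Rightarrow> bool" where
  "anchored G J s t p M \<Delta> H \<longleftrightarrow>
    (\<exists>x\<in>schedules G J s p. x t \<le> M \<and> schedule_anchored G J s p \<Delta> x H)"

definition incidence_vector :: "'v set \<Rightarrow> 'v set \<Rightarrow> 'v \<Rightarrow> real" where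
  "incidence_vector J H = restrict (indicator H) J"

definition P_Dom ::
  "'v pair_pre_digraph \<Rightarrow> 'v set \<Rightarrow> 'v \<Rightarrow> ('v \<Rightarrow> real) \<Rightarrow> real \<Rightarrow> ('v \<Rightarrow> real) set \<Rightarrow>
    (('v \<Rightarrow> real) \<times> ('v \<Rightarrow> real)) set" where
  "P_Dom G J t p M \<Delta> =
    {(z, h). z \<in> pverts G \<rightarrow>\<^sub>E UNIV \<and> h \<in> J \<rightarrow>\<^sub>E {0..1} \<and>
      (\<forall>(i, j)\<in>parcs G. z j - z i \<ge> zero_ext J p i) \<and>
      z t \<le> M \<and> (\<forall>j\<in>pverts G. z j \<ge> 0) \<and>
      (\<forall>i\<in>pverts G. \<forall>j\<in>pverts G. precedes G i j \<longrightarrow>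
        z j - z i \<ge> longest_path G J p i j
          + (robust_longest_path G J p \<Delta> i j - longest_path G J p i j) * zero_ext J h j)}"

definition Proj_h :: "(('v \<Rightarrow> real) \<times> ('v \<Rightarrow> real)) set \<Rightarrow> ('v \<Rightarrow> real) set" where
  "Proj_h P = {h. \<exists>z. (z, h) \<in> P}"

end

theory Submission
  imports Defs
begin

text \<open>
  A schedule is a potential for the arc lengths, so the longest path lengths are exactly the
  differences that its arcs force: every potential satisfies them (\<open>potential_longest_path\<close>), and
  nonnegative values prescribed on some vertices extend to a schedule if they, together with \<open>0\<close> at
  the other vertices, respect them towards each prescribed vertex (\<open>earliest_schedule\<close>). Both inclusions compare the constraints of \<open>P_Dom\<close> with this.

  Suppose \<open>(z, h) \<in> P_Dom\<close> with \<open>h\<close> the incidence vector of \<open>H\<close>. Resetting \<open>z\<close> at the source to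
  \<open>0\<close> gives a schedule \<open>x\<close> of \<open>G(p)\<close>. For \<open>\<delta> \<in> \<Delta>\<close> start every vertex as early as \<open>G(p + \<delta>)\<close> permits
  after release dates \<open>x\<^sub>i\<close> for \<open>i \<in> H\<close> and \<open>0\<close> elsewhere. No release date exceeds \<open>z\<close>, and it equals
  \<open>z\<close> on \<open>H\<close>, so the constraints \<open>z\<^sub>j - z\<^sub>i \<ge> L\<^sup>\<Delta>\<^sub>i\<^sub>j\<close> for \<open>j \<in> H\<close> imply that no job of \<open>H\<close> is delayed
  beyond its release date.

  Conversely, let \<open>H\<close> be anchored by \<open>x\<close>. The schedule \<open>x\<close> itself may violate the constraints
  from an unanchored \<open>i\<close> to an anchored \<open>j\<close>, since the job \<open>i\<close> can start later in \<open>x\<close> than a large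
  \<open>\<delta>\<close> allows. Let therefore \<open>z\<close> be the pointwise infimum of \<open>x\<close> and of all schedules of all
  \<open>G(p + \<delta>)\<close> that agree with \<open>x\<close> on \<open>H\<close>. As \<open>\<delta> \<ge> 0\<close>, these are all schedules of \<open>G(p)\<close>, and so
  is their infimum (\<open>schedules_INF\<close>); it is at most \<open>x\<close>, hence meets the deadline; and it still
  equals \<open>x\<close> on \<open>H\<close>. If \<open>\<delta>\<close> attains \<open>L\<^sup>\<Delta>\<^sub>i\<^sub>j\<close> and \<open>y\<close> is a schedule of \<open>G(p + \<delta>)\<close> agreeing with
  \<open>x\<close> on \<open>H\<close>, then \<open>z\<^sub>j = y\<^sub>j \<ge> y\<^sub>i + L\<^sup>\<Delta>\<^sub>i\<^sub>j \<ge> z\<^sub>i + L\<^sup>\<Delta>\<^sub>i\<^sub>j\<close>.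
\<close>

section \<open>Longest paths and potentials\<close>

lemma schedulesI:
  assumes "x \<in> pverts G \<rightarrow>\<^sub>E {0..}" and "x s = 0"
    and "\<And>i j. (i, j) \<in> parcs G \<Longrightarrow> x i + zero_ext J q i \<le> x j"
  shows "x \<in> schedules G J s q"
  using assms by (auto simp: schedules_def le_diff_eq add.commute)

lemma schedulesD:
  assumes "x \<in> schedules G J s q"
  shows "x \<in> pverts G \<rightarrow>\<^sub>E {0..}" and "x s = 0"
    and "\<And>i j. (i, j) \<in> parcs G \<Longrightarrow> x i + zero_ext J q i \<le> x j"
  using assms by (auto simp: schedules_def le_diff_eq add.commute)

lemma schedules_nonneg: "x \<in> schedules G J s q \<Longrightarrow> i \<in> pverts G \<Longrightarrow> 0 \<le> x i"
  by (auto simp: schedules_def PiE_def Pi_def)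

context project_network
begin

lemma closed_awalk_Nil:
  assumes "awalk i P i"
  shows "P = []"
proof (rule ccontr)
  assume "P \<noteq> []"
  then have "closed_w P"
    using assms by (auto simp: closed_w_def)
  then show False
    using closed_w_imp_cycle acyclic by simp
qed

text \<open>
  A repeated vertex would close a cycle. Hence a longest path may be extended by an arc and is
  then still a path.
\<close>

lemma awalk_imp_apath:
  assumes "awalk i P j"
  shows "apath i P j"
proof (rule ccontr)
  assume "\<not> apath i P j"
  then have "\<not> distinct (awalk_verts i P)"
    using assms by (simp add: apath_def)
  then obtain r v where "0 < length r" and "awalk v r v"
    using awalk_not_distinct_decomp[OF assms] by metis
  then show False
    using closed_awalk_Nil by auto
qed

lemma finite_path_costs: "finite {awalk_cost c P | P. apath i P j}"
  using apaths_finite[of i j] by simp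

lemma cost_le_longest_path:
  assumes "awalk i P j"
  shows "awalk_cost (\<lambda>(k, l). zero_ext J q k) P \<le> longest_path G J q i j"
  unfolding longest_path_def
  using finite_path_costs awalk_imp_apath[OF assms] by (intro Max_ge) auto

lemma longest_path_attained:
  assumes "i \<rightarrow>\<^sup>* j"
  obtains P where "awalk i P j"
    and "longest_path G J q i j = awalk_cost (\<lambda>(k, l). zero_ext J q k) P"
proof -
  let ?C = "{awalk_cost (\<lambda>(k, l). zero_ext J q k) P | P. apath i P j}"
  have "?C \<noteq> {}"
    using assms by (auto simp: reachable_apath)
  then have "longest_path G J q i j \<in> ?C"
    unfolding longest_path_def using finite_path_costs by (intro Max_in) auto
  then show thesis
    using that by (auto intro: awalkI_apath)
qed

lemma longest_path_refl: "i \<in> pverts G \<Longrightarrow> longest_path G J q i i = 0"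
proof -
  assume "i \<in> pverts G"
  then obtain P where "awalk i P i"
    and P: "longest_path G J q i i = awalk_cost (\<lambda>(k, l). zero_ext J q k) P"
    using longest_path_attained by blast
  moreover from this have "P = []"
    by (intro closed_awalk_Nil)
  ultimately show ?thesis
    by simp
qed

lemma longest_path_arc:
  assumes "i \<rightarrow>\<^sup>* k" and "(k, l) \<in> parcs G"
  shows "longest_path G J q i k + zero_ext J q k \<le> longest_path G J q i l"
proof -
  obtain P where P: "awalk i P k"
    and cost: "longest_path G J q i k = awalk_cost (\<lambda>(k, l). zero_ext J q k) P"
    using longest_path_attained[OF assms(1)] .
  have "awalk k [(k, l)] l"
    using assms(2) by (simp add: awalk_simps wellformed')
  with P have "awalk i (P @ [(k, l)]) l"
    by (rule awalk_appendI)
  from cost_le_longest_path[OF this, of q] show ?thesis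
    by (simp add: cost)
qed

text \<open>Arc lengths telescope along a path.\<close>

lemma potential_longest_path:
  assumes pot: "\<And>k l. (k, l) \<in> parcs G \<Longrightarrow> y k + zero_ext J q k \<le> y l"
    and reach: "i \<rightarrow>\<^sup>* j"
  shows "y i + longest_path G J q i j \<le> y j"
proof -
  have walk: "y i + awalk_cost (\<lambda>(k, l). zero_ext J q k) P \<le> y j" if "awalk i P j" for P
    using that
  proof (induction P arbitrary: i)
    case Nil
    then show ?case by (simp add: awalk_simps)
  next
    case (Cons e P)
    obtain l where e: "e = (i, l)" "(i, l) \<in> parcs G" "awalk l P j"
      using Cons.prems by (cases e) (auto simp: awalk_Cons_iff)
    show ?case
      using Cons.IH[OF e(3)] pot[OF e(2)] by (simp add: e(1))
  qed
  show ?thesis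
    using longest_path_attained[OF reach] walk by metis
qed

section \<open>Constructions of schedules\<close>

lemma schedules_antimono:
  assumes "\<And>i. i \<in> J \<Longrightarrow> q i \<le> q' i"
  shows "schedules G J s q' \<subseteq> schedules G J s q"
proof
  fix x assume x: "x \<in> schedules G J s q'"
  have "zero_ext J q i \<le> zero_ext J q' i" for i
    using assms by (simp add: zero_ext_def)
  then have "x i + zero_ext J q i \<le> x j" if "(i, j) \<in> parcs G" for i j
    using schedulesD(3)[OF x that] by (meson add_left_mono order_trans)
  then show "x \<in> schedules G J s q"
    using schedulesD(1,2)[OF x] by (intro schedulesI)
qed

lemma INF_schedule_le:
  assumes "Y \<subseteq> schedules G J s q" and "y \<in> Y" and "i \<in> pverts G"
  shows "(INF y\<in>Y. y i) \<le> y i"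
  using assms by (intro cINF_lower bdd_belowI[of _ 0]) (auto dest: subsetD intro: schedules_nonneg)

text \<open>
  An arc asks for \<open>y\<^sub>i + q\<^sub>i \<le> y\<^sub>j\<close>. In every \<open>y\<close> of the family the left side is at least the infimum
  of the \<open>i\<close>-th entries plus \<open>q\<^sub>i\<close>, which is thus a lower bound of the \<open>j\<close>-th entries.
\<close>

lemma schedules_INF:
  assumes ne: "Y \<noteq> {}" and Y: "Y \<subseteq> schedules G J s q"
  shows "(\<lambda>i\<in>pverts G. INF y\<in>Y. y i) \<in> schedules G J s q"
proof -
  have "(INF y\<in>Y. y i) + zero_ext J q i \<le> (INF y\<in>Y. y j)" if ij: "(i, j) \<in> parcs G" for i j
  proof (rule cINF_greatest[OF ne])
    fix y assume y: "y \<in> Y"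
    then have "y i + zero_ext J q i \<le> y j"
      using Y ij by (intro schedulesD(3)) auto
    then show "(INF y\<in>Y. y i) + zero_ext J q i \<le> y j"
      using INF_schedule_le[OF Y y wellformed'(1)[OF ij]] by linarith
  qed
  moreover have "0 \<le> (INF y\<in>Y. y i)" if "i \<in> pverts G" for i
    using Y that by (intro cINF_greatest[OF ne]) (auto intro: schedules_nonneg)
  moreover have "(INF y\<in>Y. y s) = 0"
  proof -
    have "y s = 0" if "y \<in> Y" for y
      using Y that by (auto intro: schedulesD(2))
    then have "(INF y\<in>Y. y s) = (INF y\<in>Y. 0)"
      by (intro INF_cong) auto
    then show ?thesis
      using ne by simp
  qed
  moreover have "s \<in> pverts G"
    by (simp add: verts_eq)
  ultimately show ?thesis
    by (intro schedulesI) (auto simp: wellformed')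
qed

text \<open>
  The witness starts each vertex \<open>i\<close> at the largest value of \<open>r\<^sub>k\<close> plus the length of a longest path
  from \<open>k\<close> to \<open>i\<close>. It respects an arc \<open>(i, j)\<close> because a longest path to \<open>i\<close> extends to \<open>j\<close>, and it is
  nonnegative because \<open>k = i\<close> contributes the release date of \<open>i\<close> itself. That contribution is the
  maximum at each vertex that no other release date forces to start later.
\<close>

lemma earliest_schedule:
  assumes nonneg: "\<And>i. i \<in> pverts G \<Longrightarrow> 0 \<le> r i" and source_zero: "r s = 0"
  obtains y where "y \<in> schedules G J s q"
    and "\<And>j. j \<in> pverts G \<Longrightarrow> (\<And>i. precedes G i j \<Longrightarrow> r i + longest_path G J q i j \<le> r j)
      \<Longrightarrow> y j = r j"
proof
  define T where "T j = {r i + longest_path G J q i j | i. i \<rightarrow>\<^sup>* j}" for j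
  define y where "y = (\<lambda>j\<in>pverts G. Max (T j))"
  have fin: "finite (T j)" for j
  proof -
    have "T j \<subseteq> (\<lambda>i. r i + longest_path G J q i j) ` pverts G"
      by (auto simp: T_def reachable_in_verts)
    then show ?thesis
      using pair_finite_verts finite_surj by blast
  qed
  have own: "r j \<in> T j" if "j \<in> pverts G" for j
    unfolding T_def using that longest_path_refl[OF that, of q]
    by (intro CollectI exI[of _ j]) simp
  have release: "r j \<le> y j" if "j \<in> pverts G" for j
    using Max_ge[OF fin own[OF that]] that by (simp add: y_def)
  show exact: "y j = r j"
    if "j \<in> pverts G" and "\<And>i. precedes G i j \<Longrightarrow> r i + longest_path G J q i j \<le> r j" for j
  proof -
    have "r i + longest_path G J q i j \<le> r j" if "i \<rightarrow>\<^sup>* j" for i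
      using that \<open>\<And>i. precedes G i j \<Longrightarrow> _\<close> longest_path_refl[OF \<open>j \<in> pverts G\<close>, of q]
      by (cases "i = j") (auto simp: precedes_def)
    then have "l \<le> r j" if "l \<in> T j" for l
      using that by (auto simp: T_def)
    then have "Max (T j) = r j"
      using own fin that(1) by (intro Max_eqI) auto
    then show ?thesis
      using that(1) by (simp add: y_def)
  qed
  have no_pred: "\<not> precedes G i s" for i
  proof -
    have "v = s \<longrightarrow> i = s" if "i \<rightarrow>\<^sup>* v" for v
      using that source by (induct rule: reachable_induct) auto
    then show ?thesis
      by (auto simp: precedes_def)
  qed
  have "y i + zero_ext J q i \<le> y j" if ij: "(i, j) \<in> parcs G" for i j
  proof -
    have "Max (T i) \<in> T i"
      using own wellformed'(1)[OF ij] fin by (intro Max_in) auto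
    then obtain k where k: "k \<rightarrow>\<^sup>* i" "Max (T i) = r k + longest_path G J q k i"
      unfolding T_def by blast
    have "k \<rightarrow>\<^sup>* j"
      using k(1) ij by (simp add: reachable_adj_trans)
    then have "r k + longest_path G J q k j \<le> Max (T j)"
      using fin by (intro Max_ge) (auto simp: T_def)
    then show ?thesis
      using k longest_path_arc[OF k(1) ij, of q] wellformed'[OF ij] by (simp add: y_def)
  qed
  moreover have "y s = 0"
    using exact[of s] no_pred source_zero by (simp add: verts_eq)
  moreover have "y \<in> pverts G \<rightarrow>\<^sub>E {0..}"
  proof (rule PiE_I)
    show "y j \<in> {0..}" if "j \<in> pverts G" for j
      using nonneg[OF that] release[OF that] by simp
  qed (simp add: y_def)
  ultimately show "y \<in> schedules G J s q"
    by (intro schedulesI) auto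
qed

end

section \<open>Anchored sets and the formulation\<close>

lemma robust_longest_path_max:
  assumes "robust_max_exists G J p \<Delta>" and "precedes G i j"
  obtains \<delta> where "\<delta> \<in> \<Delta>"
    and "robust_longest_path G J p \<Delta> i j = longest_path G J (vec_plus J p \<delta>) i j"
    and "\<And>\<delta>'. \<delta>' \<in> \<Delta> \<Longrightarrow>
      longest_path G J (vec_plus J p \<delta>') i j \<le> longest_path G J (vec_plus J p \<delta>) i j"
proof -
  obtain \<delta> where \<delta>: "\<delta> \<in> \<Delta>" "\<And>\<delta>'. \<delta>' \<in> \<Delta> \<Longrightarrow>
      longest_path G J (vec_plus J p \<delta>') i j \<le> longest_path G J (vec_plus J p \<delta>) i j"
    using assms unfolding robust_max_exists_def by blast
  then have "robust_longest_path G J p \<Delta> i j = longest_path G J (vec_plus J p \<delta>) i j"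
    unfolding robust_longest_path_def by (intro Greatest_equality) auto
  with \<delta> show thesis
    using that by blast
qed

context project_network
begin

lemma anchored_if_mem_P_Dom:
  assumes max: "robust_max_exists G J p \<Delta>"
    and zh: "(z, incidence_vector J H) \<in> P_Dom G J t p M \<Delta>" and "H \<subseteq> J"
  shows "anchored G J s t p M \<Delta> H"
proof -
  have z: "z \<in> pverts G \<rightarrow>\<^sub>E UNIV" "z t \<le> M"
    and z_arc: "\<And>i j. (i, j) \<in> parcs G \<Longrightarrow> z j - z i \<ge> zero_ext J p i"
    and z_nonneg: "\<And>j. j \<in> pverts G \<Longrightarrow> 0 \<le> z j"
    using zh unfolding P_Dom_def by blast+
  have anchor: "z i + robust_longest_path G J p \<Delta> i j \<le> z j" if "precedes G i j" "j \<in> H" for i j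
  proof -
    have "i \<in> pverts G" "j \<in> pverts G"
      using that(1) reachable_in_verts by (auto simp: precedes_def)
    moreover have "zero_ext J (incidence_vector J H) j = 1"
      using that(2) \<open>H \<subseteq> J\<close> by (auto simp: zero_ext_def incidence_vector_def)
    moreover have "\<forall>i\<in>pverts G. \<forall>j\<in>pverts G. precedes G i j \<longrightarrow>
        z j - z i \<ge> longest_path G J p i j
          + (robust_longest_path G J p \<Delta> i j - longest_path G J p i j)
            * zero_ext J (incidence_vector J H) j"
      using zh unfolding P_Dom_def by blast
    ultimately show ?thesis
      using that(1) by fastforce
  qed
  \<comment> \<open>No arc enters the source and the arcs leaving it have length \<open>0\<close>; with the value \<open>0\<close> at
    the source, these arcs only ask their heads to be nonnegative.\<close>
  define x where "x = z(s := 0)"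
  have "x \<in> schedules G J s p"
  proof (rule schedulesI)
    show "x \<in> pverts G \<rightarrow>\<^sub>E {0..}"
      using z(1) z_nonneg verts_eq by (auto simp: x_def PiE_iff extensional_def)
    show "x i + zero_ext J p i \<le> x j" if ij: "(i, j) \<in> parcs G" for i j
    proof -
      have "j \<noteq> s"
        using ij source by blast
      moreover have "zero_ext J p s = 0"
        using dummies by (simp add: zero_ext_def)
      ultimately show ?thesis
        using z_arc[OF ij] z_nonneg wellformed'(2)[OF ij] by (simp add: x_def)
    qed
  qed (simp add: x_def)
  moreover have "x t \<le> M"
    using z dummies by (simp add: x_def)
  moreover have "\<exists>y\<in>schedules G J s (vec_plus J p \<delta>). \<forall>j\<in>H. y j = x j" if "\<delta> \<in> \<Delta>" for \<delta>
  proof -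
    define r where "r i = (if i \<in> H then x i else 0)" for i
    have H: "j \<in> pverts G" "r j = z j" if "j \<in> H" for j
      using that \<open>H \<subseteq> J\<close> dummies verts_eq by (auto simp: r_def x_def)
    have r: "0 \<le> r i" "r i \<le> z i" if "i \<in> pverts G" for i
      using that z_nonneg by (auto simp: r_def x_def)
    have bound: "r i + longest_path G J (vec_plus J p \<delta>) i j \<le> r j"
      if "j \<in> H" "precedes G i j" for i j
    proof -
      have "longest_path G J (vec_plus J p \<delta>) i j \<le> robust_longest_path G J p \<Delta> i j"
        using robust_longest_path_max[OF max that(2)] \<open>\<delta> \<in> \<Delta>\<close> by metis
      moreover have "i \<in> pverts G"
        using that(2) reachable_in_verts by (auto simp: precedes_def)
      ultimately show ?thesis
        using anchor[OF that(2,1)] r(2)[of i] H(2)[OF that(1)] by linarith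
    qed
    have "r s = 0"
      by (simp add: r_def x_def)
    then obtain y where "y \<in> schedules G J s (vec_plus J p \<delta>)" and "\<And>j. j \<in> H \<Longrightarrow> y j = r j"
      using earliest_schedule[of r "vec_plus J p \<delta>"] r(1) bound H(1) by metis
    then show ?thesis
      by (intro bexI[of _ y]) (auto simp: r_def)
  qed
  ultimately show ?thesis
    using \<open>H \<subseteq> J\<close> by (auto simp: anchored_def schedule_anchored_def)
qed

lemma mem_P_Dom_if_anchored:
  assumes \<Delta>: "\<Delta> \<subseteq> J \<rightarrow>\<^sub>E {0..}" and max: "robust_max_exists G J p \<Delta>"
    and anch: "anchored G J s t p M \<Delta> H"
  shows "\<exists>z. (z, incidence_vector J H) \<in> P_Dom G J t p M \<Delta>"
proof -
  obtain x where x: "x \<in> schedules G J s p" "x t \<le> M" and "H \<subseteq> J"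
    and xa: "\<And>\<delta>. \<delta> \<in> \<Delta> \<Longrightarrow> \<exists>y\<in>schedules G J s (vec_plus J p \<delta>). \<forall>i\<in>H. y i = x i"
    using anch by (auto simp: anchored_def schedule_anchored_def)
  define Y where
    "Y = insert x {y. (\<exists>\<delta>\<in>\<Delta>. y \<in> schedules G J s (vec_plus J p \<delta>)) \<and> (\<forall>i\<in>H. y i = x i)}"
  have "schedules G J s (vec_plus J p \<delta>) \<subseteq> schedules G J s p" if "\<delta> \<in> \<Delta>" for \<delta>
    using \<Delta> that by (intro schedules_antimono) (force simp: vec_plus_def)
  then have Y: "Y \<subseteq> schedules G J s p" "Y \<noteq> {}"
    using x by (auto simp: Y_def)
  define z where "z = (\<lambda>i\<in>pverts G. INF y\<in>Y. y i)"
  have z: "z \<in> schedules G J s p"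
    unfolding z_def using schedules_INF[OF Y(2,1)] .
  have z_le: "z i \<le> y i" if "y \<in> Y" "i \<in> pverts G" for y i
    using INF_schedule_le[OF Y(1) that] that(2) by (simp add: z_def)
  have z_H: "z j = x j" if "j \<in> H" for j
  proof -
    have "(\<lambda>y. y j) ` Y = {x j}"
      using that by (auto simp: Y_def)
    then show ?thesis
      using that \<open>H \<subseteq> J\<close> verts_eq by (auto simp: z_def)
  qed
  have dom: "z j - z i \<ge> longest_path G J p i j
      + (robust_longest_path G J p \<Delta> i j - longest_path G J p i j)
        * zero_ext J (incidence_vector J H) j" if ij: "precedes G i j" for i j
  proof (cases "j \<in> H")
    case True
    obtain \<delta> where \<delta>: "\<delta> \<in> \<Delta>"
      "robust_longest_path G J p \<Delta> i j = longest_path G J (vec_plus J p \<delta>) i j"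
      using robust_longest_path_max[OF max ij] by metis
    obtain y where y: "y \<in> schedules G J s (vec_plus J p \<delta>)" "\<forall>i\<in>H. y i = x i"
      using xa[OF \<delta>(1)] by blast
    have reach: "i \<rightarrow>\<^sup>* j"
      using ij by (simp add: precedes_def)
    have "y i + longest_path G J (vec_plus J p \<delta>) i j \<le> y j"
      using potential_longest_path[OF schedulesD(3)[OF y(1)] reach] .
    moreover have "z i \<le> y i"
      using y \<delta> reach reachable_in_verts by (intro z_le) (auto simp: Y_def)
    moreover have "z j = y j"
      using z_H[OF True] y True by simp
    moreover have "zero_ext J (incidence_vector J H) j = 1"
      using True \<open>H \<subseteq> J\<close> by (auto simp: zero_ext_def incidence_vector_def)
    ultimately show ?thesis
      using \<delta> by simp
  next
    case False
    then have "zero_ext J (incidence_vector J H) j = 0"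
      by (simp add: zero_ext_def incidence_vector_def)
    moreover have "z i + longest_path G J p i j \<le> z j"
      using ij by (intro potential_longest_path[OF schedulesD(3)[OF z]]) (auto simp: precedes_def)
    ultimately show ?thesis
      by simp
  qed
  have "z t \<le> M"
    using z_le[of x t] x(2) by (simp add: Y_def verts_eq)
  moreover have "incidence_vector J H \<in> J \<rightarrow>\<^sub>E {0..1}"
    by (auto simp: incidence_vector_def indicator_def)
  moreover have "z \<in> pverts G \<rightarrow>\<^sub>E UNIV"
    by (simp add: z_def)
  moreover have "\<forall>(i, j)\<in>parcs G. z j - z i \<ge> zero_ext J p i"
    using schedulesD(3)[OF z] by fastforce
  moreover have "\<forall>j\<in>pverts G. 0 \<le> z j"
    using schedules_nonneg[OF z] by blast
  ultimately have "(z, incidence_vector J H) \<in> P_Dom G J t p M \<Delta>"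
    using dom unfolding P_Dom_def by blast
  then show ?thesis
    by blast
qed

end

lemma zero_one_vector_eq_incidence_vector:
  assumes "h \<in> J \<rightarrow>\<^sub>E {0, 1}"
  shows "h = incidence_vector J {j \<in> J. h j = 1}"
  using assms by (fastforce simp: incidence_vector_def indicator_def fun_eq_iff extensional_def
      PiE_def Pi_def)

theorem proposition2:
  fixes G :: "'v pair_pre_digraph" and J :: "'v set" and s t :: 'v
    and p :: "'v \<Rightarrow> real" and M :: real and \<Delta> :: "('v \<Rightarrow> real) set"
  assumes "project_network G J s t"
    and "p \<in> J \<rightarrow>\<^sub>E {0..}"
    and "M \<ge> 0"
    and "\<Delta> \<subseteq> J \<rightarrow>\<^sub>E {0..}" and "\<Delta> \<noteq> {}"
    and "robust_max_exists G J p \<Delta>"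
  shows "Proj_h (P_Dom G J t p M \<Delta>) \<inter> (J \<rightarrow>\<^sub>E {0, 1}) =
    {incidence_vector J H | H. anchored G J s t p M \<Delta> H}"
proof -
  interpret project_network G J s t
    by (fact assms(1))
  show ?thesis
  proof (intro equalityI subsetI)
    fix h assume h: "h \<in> Proj_h (P_Dom G J t p M \<Delta>) \<inter> (J \<rightarrow>\<^sub>E {0, 1})"
    let ?H = "{j \<in> J. h j = 1}"
    have h_eq: "h = incidence_vector J ?H"
      using h by (intro zero_one_vector_eq_incidence_vector) blast
    obtain z where "(z, incidence_vector J ?H) \<in> P_Dom G J t p M \<Delta>"
      using h unfolding Proj_h_def h_eq[symmetric] by blast
    then have "anchored G J s t p M \<Delta> ?H"
      by (intro anchored_if_mem_P_Dom assms) auto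
    then show "h \<in> {incidence_vector J H | H. anchored G J s t p M \<Delta> H}"
      using h_eq by blast
  next
    fix h assume "h \<in> {incidence_vector J H | H. anchored G J s t p M \<Delta> H}"
    then obtain H where H: "h = incidence_vector J H" "anchored G J s t p M \<Delta> H"
      by blast
    have "h \<in> J \<rightarrow>\<^sub>E {0, 1}"
      by (auto simp: H(1) incidence_vector_def indicator_def)
    moreover have "h \<in> Proj_h (P_Dom G J t p M \<Delta>)"
      using mem_P_Dom_if_anchored[OF assms(4,6) H(2)] by (simp add: Proj_h_def H(1))
    ultimately show "h \<in> Proj_h (P_Dom G J t p M \<Delta>) \<inter> (J \<rightarrow>\<^sub>E {0, 1})"
      by blast
  qed
qed

end
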